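(* Let $n\in\mathbb N$ and let $K\subseteq\mathbb R^n$ be an origin-symmetric convex set with nonempty interior. Let $u:\mathbb R^n\to\mathbb R$ be a $C^2$ even function (i.e. $u(-x)=u(x)$) satisfying $\mathscr{L}u=1$ on $K$, where $\mathscr{L}u(x)=\Delta u(x)-\sum_{i=1}^n x_i\partial_iu(x)$. Then $$\int \|\nabla^2u\|_{\mathrm{HS}}^2 + |\nabla u|^2 \,\mathrm{d}\gamma_K \geq \frac{1}{n}.$$
   Context: $\gamma_n$ is the standard Gaussian measure on $\mathbb R^n$ with density $(2\pi)^{-n/2}e^{-|x|^2/2}$. For a set $K$ of positive Gaussian measure, $\gamma_K$ is the probability measure $\gamma_K(A)=\gamma_n(A\cap K)/\gamma_n(K)$. $\nabla^2u$ is the Hessian of $u$ and $\|A\|_{\mathrm{HS}}^2=\sum_{i,j}a_{ij}^2$ is the squared Hilbert–Schmidt norm of a matrix $A$. *)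

theory Defs
  imports "HOL-Analysis.Analysis"
begin

definition grad :: "(real ^ 'n \<Rightarrow> real) \<Rightarrow> real ^ 'n \<Rightarrow> real ^ 'n" where
  "grad u x = (\<chi> i. frechet_derivative u (at x) (axis i 1))"

definition hess :: "(real ^ 'n \<Rightarrow> real) \<Rightarrow> real ^ 'n \<Rightarrow> real ^ 'n ^ 'n" where
  "hess u x = (\<chi> i j. frechet_derivative (\<lambda>y. grad u y $ j) (at x) (axis i 1))"

definition C2 :: "(real ^ 'n \<Rightarrow> real) \<Rightarrow> bool" where
  "C2 u \<longleftrightarrow> (\<forall>x. u differentiable (at x)) \<and>
     (\<forall>j x. (\<lambda>y. grad u y $ j) differentiable (at x)) \<and>
     (\<forall>i j. continuous_on UNIV (\<lambda>x. hess u x $ i $ j))"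

definition laplacian :: "(real ^ 'n \<Rightarrow> real) \<Rightarrow> real ^ 'n \<Rightarrow> real" where
  "laplacian u x = (\<Sum>i\<in>UNIV. hess u x $ i $ i)"

definition OU :: "(real ^ 'n \<Rightarrow> real) \<Rightarrow> real ^ 'n \<Rightarrow> real" where
  "OU u x = laplacian u x - (\<Sum>i\<in>UNIV. x $ i * grad u x $ i)"

definition hs_norm_sq :: "real ^ 'n ^ 'n \<Rightarrow> real" where
  "hs_norm_sq A = (\<Sum>i\<in>UNIV. \<Sum>j\<in>UNIV. (A $ i $ j)\<^sup>2)"

definition gaussian :: "(real ^ 'n) measure" where
  "gaussian = density lebesgue
     (\<lambda>x. ennreal ((2 * pi) powr (- real CARD('n) / 2) * exp (- (norm x)\<^sup>2 / 2)))"

definition gaussian_restr :: "(real ^ 'n) set \<Rightarrow> (real ^ 'n) measure" where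
  "gaussian_restr K = density gaussian (\<lambda>x. indicator K x / emeasure gaussian K)"

end

theory Submission
  imports Defs "HOL-Probability.Distributions"
begin

text \<open>
  Put \<open>c = 1 / n\<close>. For each \<open>j\<close> the function \<open>\<phi>\<^sub>j = \<partial>\<^sub>j u - c x\<^sub>j\<close> is odd, so the Gaussian measure on a symmetric
  convex set satisfies the Poincare inequality \<open>\<integral> \<phi>\<^sub>j\<^sup>2 \<le> \<integral> |\<nabla>\<phi>\<^sub>j|\<^sup>2\<close>. Summing over \<open>j\<close> and expanding the squares
  gives \<open>\<integral> |\<nabla>\<^sup>2u|\<^sup>2 \<ge> \<integral> |\<nabla>u|\<^sup>2 + 2c \<integral> L u - c\<^sup>2 n + c\<^sup>2 \<integral> |x|\<^sup>2 \<ge> 2c - c\<^sup>2 n = 1 / n\<close>, because \<open>L u = 1\<close>.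

  The Poincare inequality is linearized from the Prekopa-Leindler inequality applied to \<open>exp (e \<phi>)\<close>,
  \<open>exp (- e \<phi>)\<close> and \<open>exp (e\<^sup>2 (|\<nabla>\<phi>|\<^sup>2 + \<delta>) / 2)\<close> times the Gaussian weight; by oddness the first two have the
  same integral, which is that of \<open>cosh (e \<phi>) \<ge> 1 + e\<^sup>2 \<phi>\<^sup>2 / 2\<close>. This is done on bounded pieces of \<open>K\<close>, where
  \<open>\<nabla>\<phi>\<close> is uniformly continuous.
\<close>

subsection \<open>The Prekopa-Leindler inequality\<close>

text \<open>If \<open>A\<close> is bounded above with supremum \<open>s\<close>, the cuts at
  \<open>s - 1 / Suc n\<close> increase to \<open>A\<close> without \<open>s\<close>. Each cut lies
  in a segment ending at a point of \<open>A\<close>, and \<open>{s}\<close> is null, so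
  \<open>s\<close> need not belong to \<open>A\<close>. If \<open>A\<close> is unbounded, cuts at
  the naturals do the same. This replaces extreme points, which a Borel set may lack.\<close>

lemma emeasure_le_if_initial_segments_le:
  fixes A :: "real set"
  assumes [measurable]: "A \<in> sets borel"
    and le: "\<And>a. a \<in> A \<Longrightarrow> emeasure lborel (A \<inter> {..a}) \<le> c"
  shows "emeasure lborel A \<le> c"
proof (cases "bdd_above A")
  case bdd: True
  show ?thesis
  proof (cases "A = {}")
    case False
    define s where "s = Sup A"
    define X where "X n = A \<inter> {..s - 1 / real (Suc n)}" for n
    have ub: "a \<le> s" if "a \<in> A" for a
      using cSup_upper[OF that bdd] by (simp add: s_def)
    have "emeasure lborel (X n) \<le> c" for n
    proof -
      have "s - 1 / real (Suc n) < s" by simp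
      then obtain a where a: "a \<in> A" "s - 1 / real (Suc n) < a"
        using False unfolding s_def by (meson less_cSup_iff bdd)
      have "emeasure lborel (X n) \<le> emeasure lborel (A \<inter> {..a})"
        using a unfolding X_def by (intro emeasure_mono) auto
      with le[OF a(1)] show ?thesis by (rule order_trans[rotated])
    qed
    moreover have "incseq X"
    proof (rule incseq_SucI)
      fix n
      have "1 / real (Suc (Suc n)) \<le> 1 / real (Suc n)" by (simp add: field_simps)
      then show "X n \<subseteq> X (Suc n)" unfolding X_def by auto
    qed
    moreover have "range X \<subseteq> sets lborel" unfolding X_def by auto
    ultimately have "emeasure lborel (\<Union>n. X n) \<le> c"
      by (subst SUP_emeasure_incseq[symmetric]) (auto intro: SUP_least)
    moreover have "A \<subseteq> (\<Union>n. X n) \<union> {s}"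
    proof
      fix x assume x: "x \<in> A"
      show "x \<in> (\<Union>n. X n) \<union> {s}"
      proof (cases "x = s")
        case False
        then have "0 < s - x" using ub[OF x] by auto
        then obtain n where "inverse (real (Suc n)) < s - x" using reals_Archimedean by blast
        with x have "x \<in> X n" unfolding X_def by (auto simp: field_simps)
        then show ?thesis by auto
      qed auto
    qed
    moreover have "emeasure lborel ((\<Union>n. X n) \<union> {s}) = emeasure lborel (\<Union>n. X n)"
      by (intro emeasure_Un_null_set) (auto simp: X_def)
    moreover have "(\<Union>n. X n) \<union> {s} \<in> sets lborel" unfolding X_def by measurable
    ultimately show ?thesis by (metis emeasure_mono order_trans)
  qed simp
next
  case unbdd: False
  have "emeasure lborel (A \<inter> {..real n}) \<le> c" for n
  proof -
    obtain a where a: "a \<in> A" "real n < a" using unbdd by (meson bdd_above.I not_le)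
    have "emeasure lborel (A \<inter> {..real n}) \<le> emeasure lborel (A \<inter> {..a})"
      using a by (intro emeasure_mono) auto
    with le[OF a(1)] show ?thesis by (rule order_trans[rotated])
  qed
  moreover have "(SUP n. emeasure lborel (A \<inter> {..real n})) = emeasure lborel (\<Union>n. A \<inter> {..real n})"
    by (intro SUP_emeasure_incseq) (auto simp: incseq_def)
  moreover have "(\<Union>n. A \<inter> {..real n}) = A" by (auto simp: real_arch_simple)
  ultimately show ?thesis by (metis SUP_least)
qed

text \<open>Reflection at the origin preserves \<open>lborel\<close> and exchanges initial with
  final segments.\<close>

lemma emeasure_le_if_final_segments_le:
  fixes A :: "real set"
  assumes [measurable]: "A \<in> sets borel"
    and le: "\<And>a. a \<in> A \<Longrightarrow> emeasure lborel (A \<inter> {a..}) \<le> c"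
  shows "emeasure lborel A \<le> c"
proof -
  have refl: "emeasure lborel S = emeasure lborel (uminus -` S)" if "S \<in> sets borel" for S :: "real set"
  proof -
    have [measurable]: "S \<in> sets borel" by fact
    have "emeasure lborel S = emeasure (distr lborel borel uminus) S"
      by (simp add: lborel_distr_uminus)
    also have "\<dots> = emeasure lborel (uminus -` S)"
      by (subst emeasure_distr) auto
    finally show ?thesis .
  qed
  have "emeasure lborel (uminus -` A) \<le> c"
  proof (rule emeasure_le_if_initial_segments_le)
    show "uminus -` A \<in> sets borel"
      using measurable_sets[of uminus borel borel A] by simp
    fix a assume "a \<in> uminus -` A"
    then have "emeasure lborel (A \<inter> {-a..}) \<le> c" using le by auto
    also have "emeasure lborel (A \<inter> {-a..}) = emeasure lborel (uminus -` A \<inter> {..a})"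
      by (subst refl) (auto intro!: arg_cong[where f = "emeasure lborel"])
    finally show "emeasure lborel (uminus -` A \<inter> {..a}) \<le> c" .
  qed
  then show ?thesis by (simp add: refl[OF assms(1)])
qed

text \<open>Subtraction truncates at 0; \<open>b \<le> c\<close> rules out the case in which the
  difference carries no information.\<close>

lemma ennreal_add_le_if_le_diff:
  fixes a b c :: ennreal
  shows "a \<le> c - b \<Longrightarrow> b \<le> c \<Longrightarrow> a + b \<le> c"
  by (auto simp: ennreal_le_minus_iff dest: leD)

text \<open>Brunn-Minkowski in dimension one. The set of midpoints of two Borel sets need not be
  Borel, so a measurable \<open>C\<close> containing it is given separately.\<close>

lemma brunn_minkowski_real:
  fixes A B C :: "real set"
  assumes [measurable]: "A \<in> sets borel" "B \<in> sets borel" "C \<in> sets borel"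
    and ne: "A \<noteq> {}" "B \<noteq> {}"
    and mid: "\<And>a b. a \<in> A \<Longrightarrow> b \<in> B \<Longrightarrow> (a + b) / 2 \<in> C"
  shows "emeasure lborel A + emeasure lborel B \<le> 2 * emeasure lborel C"
proof -
  \<comment> \<open>The translates of \<open>A \<inter> {..a}\<close> by \<open>b\<close> and of \<open>B \<inter> {b..}\<close> by \<open>a\<close> lie in \<open>2 C\<close> on opposite sides of \<open>a + b\<close>.\<close>
  have *: "emeasure lborel (A \<inter> {..a}) + emeasure lborel (B \<inter> {b..}) \<le> 2 * emeasure lborel C"
    if ab: "a \<in> A" "b \<in> B" for a b
  proof -
    have "emeasure lborel (A \<inter> {..a}) = (\<integral>\<^sup>+x. indicator (A \<inter> {..a}) x \<partial>lborel)"
      by simp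
    also have "\<dots> = 2 * (\<integral>\<^sup>+x. indicator (A \<inter> {..a}) (- b + 2 * x) \<partial>lborel)"
      by (subst nn_integral_real_affine[where c = 2 and t = "-b"]) auto
    finally have A: "emeasure lborel (A \<inter> {..a}) = 2 * (\<integral>\<^sup>+x. indicator (A \<inter> {..a}) (- b + 2 * x) \<partial>lborel)" .
    have "emeasure lborel (B \<inter> {b..}) = (\<integral>\<^sup>+x. indicator (B \<inter> {b..}) x \<partial>lborel)"
      by simp
    also have "\<dots> = 2 * (\<integral>\<^sup>+x. indicator (B \<inter> {b..}) (- a + 2 * x) \<partial>lborel)"
      by (subst nn_integral_real_affine[where c = 2 and t = "-a"]) auto
    finally have B: "emeasure lborel (B \<inter> {b..}) = 2 * (\<integral>\<^sup>+x. indicator (B \<inter> {b..}) (- a + 2 * x) \<partial>lborel)" .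
    have "(\<integral>\<^sup>+x. indicator (A \<inter> {..a}) (- b + 2 * x) \<partial>lborel) + (\<integral>\<^sup>+x. indicator (B \<inter> {b..}) (- a + 2 * x) \<partial>lborel)
      = (\<integral>\<^sup>+x. indicator (A \<inter> {..a}) (- b + 2 * x) + indicator (B \<inter> {b..}) (- a + 2 * x) \<partial>lborel)"
      by (subst nn_integral_add) auto
    also have "\<dots> \<le> (\<integral>\<^sup>+x. indicator C x \<partial>lborel)"
    proof (rule nn_integral_mono_AE)
      \<comment> \<open>After halving, the two translates can meet only at
        \<open>(a + b) / 2\<close>, a null set; elsewhere the sum of the indicators is at most
        one.\<close>
      show "AE x in lborel. indicator (A \<inter> {..a}) (- b + 2 * x) + indicator (B \<inter> {b..}) (- a + 2 * x)
          \<le> (indicator C x :: ennreal)"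
        using AE_lborel_singleton[of "(a + b) / 2"]
      proof eventually_elim
        case (elim x)
        have "x \<in> C" if "- b + 2 * x \<in> A" using mid[OF that ab(2)] by simp
        moreover have "x \<in> C" if "- a + 2 * x \<in> B" using mid[OF ab(1) that] by simp
        moreover have "\<not> (- b + 2 * x \<le> a \<and> b \<le> - a + 2 * x)" using elim by auto
        ultimately show ?case by (auto split: split_indicator)
      qed
    qed
    also have "\<dots> = emeasure lborel C" by simp
    finally show ?thesis unfolding A B distrib_left[symmetric] by (intro mult_left_mono) auto
  qed
  \<comment> \<open>Subtracting the measure of the final segment of \<open>B\<close> leaves a bound
    independent of \<open>a\<close>, so the segments of \<open>A\<close> can be replaced by
    \<open>A\<close>. The same is then done for \<open>B\<close>.\<close>
  have 1: "emeasure lborel A + emeasure lborel (B \<inter> {b..}) \<le> 2 * emeasure lborel C" if b: "b \<in> B" for b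
  proof -
    have "emeasure lborel A \<le> 2 * emeasure lborel C - emeasure lborel (B \<inter> {b..})"
      by (rule emeasure_le_if_initial_segments_le) (simp_all add: ennreal_le_minus_iff *[OF _ b])
    moreover obtain a where "a \<in> A" using ne(1) by auto
    then have "emeasure lborel (B \<inter> {b..}) \<le> 2 * emeasure lborel C"
      using b by (intro order_trans[OF _ *[of a b]]) simp_all
    ultimately show ?thesis by (rule ennreal_add_le_if_le_diff)
  qed
  have "emeasure lborel B \<le> 2 * emeasure lborel C - emeasure lborel A"
    by (rule emeasure_le_if_final_segments_le)
      (simp_all add: ennreal_le_minus_iff 1 add.commute[of "emeasure lborel (B \<inter> _)"])
  moreover obtain b where "b \<in> B" using ne(2) by auto
  then have "emeasure lborel A \<le> 2 * emeasure lborel C"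
    by (intro order_trans[OF _ 1[of b]]) simp_all
  ultimately have "emeasure lborel B + emeasure lborel A \<le> 2 * emeasure lborel C"
    by (rule ennreal_add_le_if_le_diff)
  then show ?thesis by (simp only: add.commute)
qed

text \<open>Layer-cake formula: \<open>min 1 (F x)\<close> is the length of the set of levels
  \<open>s\<close> in the unit interval below \<open>F x\<close>, and Tonelli exchanges the
  integrals. Only levels below 1 occur, which are those at which functions of supremum 1 have
  nonempty superlevel sets.\<close>

lemma nn_integral_min_1_eq:
  fixes F :: "real \<Rightarrow> ennreal"
  assumes [measurable]: "F \<in> borel_measurable borel"
  shows "(\<integral>\<^sup>+x. min 1 (F x) \<partial>lborel)
    = (\<integral>\<^sup>+s. indicator {0<..<1} s * emeasure lborel {x. ennreal s < F x} \<partial>lborel)"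
proof -
  have *: "min 1 (F x) = (\<integral>\<^sup>+s. indicator {0<..<1} s * indicator {x. ennreal s < F x} x \<partial>lborel)" for x
  proof -
    define t where "t = enn2real (min 1 (F x))"
    have "min 1 (F x) < top" by (simp add: min_less_iff_disj)
    then have t: "ennreal t = min 1 (F x)" "0 \<le> t" by (auto simp: t_def)
    then have t1: "t \<le> 1" by (metis ennreal_le_1 min.cobounded1)
    have iff: "ennreal s < F x \<longleftrightarrow> s < t" if "0 < s" "s < 1" for s
    proof -
      have "ennreal s < F x \<longleftrightarrow> ennreal s < ennreal t"
        unfolding t using that by (simp add: min_less_iff_conj)
      then show ?thesis using that by (simp add: ennreal_less_iff)
    qed
    have "(\<integral>\<^sup>+s. indicator {0<..<1} s * indicator {x. ennreal s < F x} x \<partial>lborel)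
      = (\<integral>\<^sup>+s. indicator {0<..<t} s \<partial>lborel)"
      using iff t1 by (intro nn_integral_cong) (auto split: split_indicator)
    also have "\<dots> = ennreal t" using t(2) by simp
    finally show ?thesis using t(1) by simp
  qed
  have "(\<integral>\<^sup>+x. min 1 (F x) \<partial>lborel) =
    (\<integral>\<^sup>+x. (\<integral>\<^sup>+s. indicator {0<..<1} s * indicator {x. ennreal s < F x} x \<partial>lborel) \<partial>lborel)"
    by (simp add: *)
  also have "\<dots> = (\<integral>\<^sup>+s. (\<integral>\<^sup>+x. indicator {0<..<1} s * indicator {x. ennreal s < F x} x \<partial>lborel) \<partial>lborel)"
    by (rule lborel_pair.Fubini'[symmetric]) measurable
  also have "\<dots> = (\<integral>\<^sup>+s. indicator {0<..<1} s * emeasure lborel {x. ennreal s < F x} \<partial>lborel)"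
    by (intro nn_integral_cong) (simp add: nn_integral_cmult)
  finally show ?thesis .
qed

text \<open>Equal suprema make the superlevel sets of \<open>f\<close> and \<open>g\<close> nonempty
  at the same levels. Midpoints of these sets lie in the superlevel set of \<open>h\<close>, so
  Brunn-Minkowski applies level by level. Thus the arithmetic mean of the integrals is bounded,
  which is more than their geometric mean.\<close>

lemma prekopa_leindler_real_normalized:
  fixes f g h :: "real \<Rightarrow> ennreal"
  assumes [measurable]: "f \<in> borel_measurable borel" "g \<in> borel_measurable borel" "h \<in> borel_measurable borel"
    and sup: "(SUP x. f x) = 1" "(SUP x. g x) = 1"
    and mid: "\<And>x y. f x * g y \<le> (h ((x + y) / 2))\<^sup>2"
  shows "(\<integral>\<^sup>+x. f x \<partial>lborel) + (\<integral>\<^sup>+x. g x \<partial>lborel) \<le> 2 * (\<integral>\<^sup>+x. h x \<partial>lborel)"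
proof -
  have f1: "min 1 (f x) = f x" and g1: "min 1 (g x) = g x" for x
    using SUP_upper[of x UNIV f] SUP_upper[of x UNIV g] by (auto simp: sup min_def)
  have "(\<integral>\<^sup>+x. f x \<partial>lborel) + (\<integral>\<^sup>+x. g x \<partial>lborel)
    = (\<integral>\<^sup>+s. indicator {0<..<1} s * emeasure lborel {x. ennreal s < f x}
      + indicator {0<..<1} s * emeasure lborel {x. ennreal s < g x} \<partial>lborel)"
    using nn_integral_min_1_eq[of f] nn_integral_min_1_eq[of g]
    by (subst nn_integral_add) (auto simp: f1 g1)
  also have "\<dots> \<le> (\<integral>\<^sup>+s. 2 * (indicator {0<..<1} s * emeasure lborel {x. ennreal s < h x}) \<partial>lborel)"
  proof (rule nn_integral_mono)
    fix s :: real
    show "indicator {0<..<1} s * emeasure lborel {x. ennreal s < f x}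
      + indicator {0<..<1} s * emeasure lborel {x. ennreal s < g x}
      \<le> 2 * (indicator {0<..<1} s * emeasure lborel {x. ennreal s < h x})"
    proof (cases "s \<in> {0<..<1}")
      case True
      have "emeasure lborel {x. ennreal s < f x} + emeasure lborel {x. ennreal s < g x}
        \<le> 2 * emeasure lborel {x. ennreal s < h x}"
      proof (rule brunn_minkowski_real)
        have "ennreal s < 1" using True by auto
        then show "{x. ennreal s < f x} \<noteq> {}" "{x. ennreal s < g x} \<noteq> {}"
          using sup by (metis (mono_tags) less_SUP_iff empty_Collect_eq)+
        fix a b assume ab: "a \<in> {x. ennreal s < f x}" "b \<in> {x. ennreal s < g x}"
        obtain r t where "f a = ennreal r" "0 \<le> r" "g b = ennreal t" "0 \<le> t"
          by (metis f1 g1 ennreal_cases ennreal_one_neq_top min_top2 min.commute)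
        then have "ennreal s * ennreal s < f a * g b"
          using ab True by (auto simp: ennreal_mult[symmetric] ennreal_less_iff intro!: mult_strict_mono)
        also have "\<dots> \<le> (h ((a + b) / 2))\<^sup>2" by (rule mid)
        finally have "(ennreal s)\<^sup>2 < (h ((a + b) / 2))\<^sup>2" by (simp add: power2_eq_square)
        then show "(a + b) / 2 \<in> {x. ennreal s < h x}"
          by (metis (mono_tags) linorder_not_le mem_Collect_eq power_mono zero_le)
      qed measurable
      then show ?thesis using True by simp
    qed simp
  qed
  also have "\<dots> = 2 * (\<integral>\<^sup>+x. min 1 (h x) \<partial>lborel)"
    by (subst nn_integral_cmult) (auto simp: nn_integral_min_1_eq)
  also have "\<dots> \<le> 2 * (\<integral>\<^sup>+x. h x \<partial>lborel)"
    by (intro mult_left_mono nn_integral_mono) auto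
  finally show ?thesis .
qed

text \<open>Boundedness makes the suprema finite. Dividing \<open>f\<close> and \<open>g\<close> by
  their suprema reduces to the normalized case, and the arithmetic-geometric mean inequality turns
  the sum into the product.\<close>

lemma prekopa_leindler_real_bounded:
  fixes f g h :: "real \<Rightarrow> ennreal" and N :: real
  assumes [measurable]: "f \<in> borel_measurable borel" "g \<in> borel_measurable borel" "h \<in> borel_measurable borel"
    and bd: "\<And>x. f x \<le> ennreal N" "\<And>x. g x \<le> ennreal N"
    and mid: "\<And>x y. f x * g y \<le> (h ((x + y) / 2))\<^sup>2"
  shows "(\<integral>\<^sup>+x. f x \<partial>lborel) * (\<integral>\<^sup>+x. g x \<partial>lborel) \<le> (\<integral>\<^sup>+x. h x \<partial>lborel)\<^sup>2"
proof -
  have "(SUP x. f x) \<le> ennreal N" "(SUP x. g x) \<le> ennreal N"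
    using bd by (auto intro: SUP_least)
  then obtain a b where a: "(SUP x. f x) = ennreal a" "0 \<le> a" and b: "(SUP x. g x) = ennreal b" "0 \<le> b"
    by (metis ennreal_cases ennreal_neq_top neq_top_trans)
  show ?thesis
  proof (cases "a = 0 \<or> b = 0")
    case True
    then have "(\<forall>x. f x = 0) \<or> (\<forall>x. g x = 0)"
      using a b SUP_upper[of _ UNIV f] SUP_upper[of _ UNIV g] by auto
    then show ?thesis by auto
  next
    case False
    with a b have ab: "0 < a" "0 < b" by auto
    \<comment> \<open>This scaling of \<open>h\<close> preserves the midpoint hypothesis, since its
      square is the product of the scalings of \<open>f\<close> and \<open>g\<close>.\<close>
    define r where "r = 1 / sqrt (a * b)"
    have r: "0 < r" "r\<^sup>2 = (1 / a) * (1 / b)"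
      using ab by (simp_all add: r_def power_divide)
    define I J H where "I = (\<integral>\<^sup>+x. f x \<partial>lborel)" and "J = (\<integral>\<^sup>+x. g x \<partial>lborel)" and "H = (\<integral>\<^sup>+x. h x \<partial>lborel)"
    have sum: "ennreal (1 / a) * I + ennreal (1 / b) * J \<le> 2 * (ennreal r * H)"
      unfolding I_def J_def H_def
      apply (subst (1 2 3) nn_integral_cmult[symmetric], (simp_all)[3])
    proof (rule prekopa_leindler_real_normalized)
      show "(SUP x. ennreal (1 / a) * f x) = 1" "(SUP x. ennreal (1 / b) * g x) = 1"
        using ab by (simp_all add: SUP_mult_left_ennreal[symmetric] a(1) b(1) ennreal_mult[symmetric])
      fix x y
      have "ennreal (1 / a) * f x * (ennreal (1 / b) * g y) = (ennreal (1 / a) * ennreal (1 / b)) * (f x * g y)"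
        by (simp add: ac_simps)
      also have "ennreal (1 / a) * ennreal (1 / b) = (ennreal r)\<^sup>2"
        using r ab by (simp add: ennreal_mult[symmetric] ennreal_power)
      also have "(ennreal r)\<^sup>2 * (f x * g y) \<le> (ennreal r)\<^sup>2 * (h ((x + y) / 2))\<^sup>2"
        by (intro mult_left_mono mid) auto
      finally show "ennreal (1 / a) * f x * (ennreal (1 / b) * g y) \<le> (ennreal r * h ((x + y) / 2))\<^sup>2"
        by (simp add: power_mult_distrib)
    qed auto
    show ?thesis
    proof (cases "H = top")
      case True
      then show ?thesis by (simp add: H_def power2_eq_square ennreal_top_mult)
    next
      case False
      then have fin: "2 * (ennreal r * H) < top" by (simp add: ennreal_mult_eq_top_iff less_top[symmetric])
      then have "ennreal (1 / a) * I < top" "ennreal (1 / b) * J < top"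
        using le_less_trans[OF sum fin] by auto
      then have "I \<noteq> top" "J \<noteq> top"
        using ab by (auto simp: ennreal_mult_top)
      with False obtain i j k where ijk: "I = ennreal i" "0 \<le> i" "J = ennreal j" "0 \<le> j" "H = ennreal k" "0 \<le> k"
        by (metis ennreal_cases)
      have "ennreal (1 / a * i + 1 / b * j) \<le> ennreal (2 * (r * k))"
      proof -
        have "ennreal (1 / a * i + 1 / b * j) = ennreal (1 / a) * I + ennreal (1 / b) * J"
          using ab ijk by (simp only: ennreal_mult' ennreal_plus mult_nonneg_nonneg divide_nonneg_nonneg
            zero_le_one less_imp_le)
        moreover have "ennreal (2 * (r * k)) = 2 * (ennreal r * H)"
          using r ijk by (simp only: ennreal_mult' mult_nonneg_nonneg less_imp_le) simp
        ultimately show ?thesis using sum by simp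
      qed
      then have "1 / a * i + 1 / b * j \<le> 2 * (r * k)"
        using ijk r by (subst (asm) ennreal_le_iff) auto
      moreover have "0 \<le> 1 / a * i + 1 / b * j" using ijk ab by simp
      ultimately have "(1 / a * i + 1 / b * j)\<^sup>2 \<le> (2 * (r * k))\<^sup>2"
        by (intro power_mono)
      \<comment> \<open>Arithmetic-geometric mean inequality, in the form
        \<open>4 * p * q \<le> (p + q)^2\<close>; the common factor \<open>1 / (a * b)\<close> then
        cancels.\<close>
      have "4 * (1 / a * (1 / b) * (i * j)) = 4 * ((1 / a * i) * (1 / b * j))" by simp
      also have "\<dots> \<le> (1 / a * i + 1 / b * j)\<^sup>2"
        using sum_squares_bound[of "1 / a * i" "1 / b * j"] by (simp only: power2_sum)
      also have "\<dots> \<le> (2 * (r * k))\<^sup>2" by fact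
      also have "\<dots> = 4 * (1 / a * (1 / b) * k\<^sup>2)" using r by (simp add: power_mult_distrib)
      finally have "1 / a * (1 / b) * (i * j) \<le> 1 / a * (1 / b) * k\<^sup>2" by linarith
      then have "i * j \<le> k\<^sup>2"
        by (rule mult_left_le_imp_le) (use ab in simp)
      then show ?thesis
        unfolding I_def[symmetric] J_def[symmetric] H_def[symmetric] using ijk
        by (simp add: ennreal_mult[symmetric] ennreal_power)
    qed
  qed
qed

section \<open>From bounded functions on the line to arbitrary dimension\<close>

lemma nn_integral_eq_SUP_min_of_nat:
  fixes f :: "'a \<Rightarrow> ennreal"
  assumes [measurable]: "f \<in> borel_measurable M"
  shows "(\<integral>\<^sup>+x. f x \<partial>M) = (SUP n. \<integral>\<^sup>+x. min (f x) (of_nat n) \<partial>M)"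
proof -
  have "(SUP n. min (f x) (of_nat n)) = f x" for x
  proof -
    have "(SUP n. min (f x) (of_nat n)) = inf (f x) (SUP n. of_nat n)"
      unfolding inf_min[symmetric] inf_SUP ..
    then show ?thesis by (simp add: ennreal_SUP_of_nat_eq_top)
  qed
  moreover have "(\<integral>\<^sup>+x. (SUP n. min (f x) (of_nat n)) \<partial>M) = (SUP n. \<integral>\<^sup>+x. min (f x) (of_nat n) \<partial>M)"
    by (rule nn_integral_monotone_convergence_SUP)
      (auto simp: incseq_def le_fun_def intro: min.coboundedI2)
  ultimately show ?thesis by simp
qed

text \<open>Truncating \<open>f\<close> and \<open>g\<close> from above keeps the midpoint
  hypothesis with the same \<open>h\<close>; monotone convergence removes the truncations.\<close>

lemma prekopa_leindler_real:
  fixes f g h :: "real \<Rightarrow> ennreal"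
  assumes [measurable]: "f \<in> borel_measurable borel" "g \<in> borel_measurable borel" "h \<in> borel_measurable borel"
    and mid: "\<And>x y. f x * g y \<le> (h ((x + y) / 2))\<^sup>2"
  shows "(\<integral>\<^sup>+x. f x \<partial>lborel) * (\<integral>\<^sup>+x. g x \<partial>lborel) \<le> (\<integral>\<^sup>+x. h x \<partial>lborel)\<^sup>2"
proof -
  have "(\<integral>\<^sup>+x. min (f x) (of_nat m) \<partial>lborel) * (\<integral>\<^sup>+x. min (g x) (of_nat n) \<partial>lborel)
      \<le> (\<integral>\<^sup>+x. h x \<partial>lborel)\<^sup>2" for m n
  proof (rule prekopa_leindler_real_bounded)
    have *: "of_nat m \<le> ennreal (max (real m) (real n))" "of_nat n \<le> ennreal (max (real m) (real n))"
      by (simp_all add: ennreal_of_nat_eq_real_of_nat)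
    show "min (f x) (of_nat m) \<le> ennreal (max (real m) (real n))" for x
      by (rule order_trans[OF min.cobounded2 *(1)])
    show "min (g x) (of_nat n) \<le> ennreal (max (real m) (real n))" for x
      by (rule order_trans[OF min.cobounded2 *(2)])
    show "min (f x) (of_nat m) * min (g y) (of_nat n) \<le> (h ((x + y) / 2))\<^sup>2" for x y
      by (rule order_trans[OF mult_mono mid]) auto
  qed auto
  then have "(SUP m. \<integral>\<^sup>+x. min (f x) (of_nat m) \<partial>lborel) * (SUP n. \<integral>\<^sup>+x. min (g x) (of_nat n) \<partial>lborel)
      \<le> (\<integral>\<^sup>+x. h x \<partial>lborel)\<^sup>2"
    unfolding SUP_mult_left_ennreal SUP_mult_right_ennreal by (auto intro!: SUP_least)
  then show ?thesis
    using nn_integral_eq_SUP_min_of_nat[of f lborel] nn_integral_eq_SUP_min_of_nat[of g lborel] by simp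
qed

text \<open>Induction on the coordinates: the inequality on the line says that integrating out one
  coordinate gives marginals that again satisfy the midpoint hypothesis. Points of the product space
  are \<open>undefined\<close> off \<open>I\<close>, hence the restriction to
  \<open>extensional I\<close>.\<close>

lemma prekopa_leindler_PiM:
  fixes f g h :: "('i \<Rightarrow> real) \<Rightarrow> ennreal"
  assumes "finite I"
    and "f \<in> borel_measurable (PiM I (\<lambda>_. lborel))" "g \<in> borel_measurable (PiM I (\<lambda>_. lborel))"
      "h \<in> borel_measurable (PiM I (\<lambda>_. lborel))"
    and "\<And>x y. x \<in> extensional I \<Longrightarrow> y \<in> extensional I \<Longrightarrow> f x * g y \<le> (h (\<lambda>i\<in>I. (x i + y i) / 2))\<^sup>2"
  shows "(\<integral>\<^sup>+x. f x \<partial>PiM I (\<lambda>_. lborel)) * (\<integral>\<^sup>+x. g x \<partial>PiM I (\<lambda>_. lborel))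
    \<le> (\<integral>\<^sup>+x. h x \<partial>PiM I (\<lambda>_. lborel))\<^sup>2"
  using assms
proof (induction I arbitrary: f g h rule: finite_induct)
  case empty
  interpret product_sigma_finite "\<lambda>_::'i. lborel :: real measure" by standard
  \<comment> \<open>Over the empty index set the product measure is the unit mass at this one
    function.\<close>
  have "f (\<lambda>_. undefined) * g (\<lambda>_. undefined) \<le> (h (\<lambda>_. undefined))\<^sup>2"
    using empty(4)[of "\<lambda>_. undefined" "\<lambda>_. undefined"] by (simp add: restrict_def)
  then show ?case by (simp add: nn_integral_empty)
next
  case (insert i I)
  interpret product_sigma_finite "\<lambda>_::'i. lborel :: real measure" by standard
  note [measurable] = insert.prems(1-3)
  have upd: "(\<lambda>t. x(i := t)) \<in> measurable lborel (PiM (insert i I) (\<lambda>_. lborel))"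
    if "x \<in> extensional I" for x
    using that by (intro measurable_fun_upd[where J = I]) (auto simp: space_PiM PiE_def)
  have m: "(\<lambda>t. F (x(i := t))) \<in> borel_measurable borel"
    if "x \<in> extensional I" "F \<in> borel_measurable (PiM (insert i I) (\<lambda>_. lborel))"
    for x and F :: "_ \<Rightarrow> ennreal"
    using measurable_compose[OF upd that(2)] that(1) by simp
  have "(\<integral>\<^sup>+t. f (x(i := t)) \<partial>lborel) * (\<integral>\<^sup>+t. g (y(i := t)) \<partial>lborel)
      \<le> (\<integral>\<^sup>+t. h ((\<lambda>i\<in>I. (x i + y i) / 2)(i := t)) \<partial>lborel)\<^sup>2"
    if xy: "x \<in> extensional I" "y \<in> extensional I" for x y
  proof (rule prekopa_leindler_real)
    fix s t :: real
    have "f (x(i := s)) * g (y(i := t)) \<le> (h (\<lambda>j\<in>insert i I. ((x(i := s)) j + (y(i := t)) j) / 2))\<^sup>2"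
      using xy by (intro insert.prems(4)) (auto simp: extensional_def)
    also have "(\<lambda>j\<in>insert i I. ((x(i := s)) j + (y(i := t)) j) / 2) = (\<lambda>i\<in>I. (x i + y i) / 2)(i := (s + t) / 2)"
      by auto
    finally show "f (x(i := s)) * g (y(i := t)) \<le> (h ((\<lambda>i\<in>I. (x i + y i) / 2)(i := (s + t) / 2)))\<^sup>2" .
  qed (use xy in \<open>auto intro!: m\<close>)
  then have "(\<integral>\<^sup>+x. (\<integral>\<^sup>+t. f (x(i := t)) \<partial>lborel) \<partial>PiM I (\<lambda>_. lborel))
      * (\<integral>\<^sup>+x. (\<integral>\<^sup>+t. g (x(i := t)) \<partial>lborel) \<partial>PiM I (\<lambda>_. lborel))
    \<le> (\<integral>\<^sup>+x. (\<integral>\<^sup>+t. h (x(i := t)) \<partial>lborel) \<partial>PiM I (\<lambda>_. lborel))\<^sup>2"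
    by (intro insert.IH) measurable
  then show ?case
    using insert.hyps insert.prems by (simp add: product_nn_integral_insert)
qed

text \<open>The coordinate map \<open>T\<close> carries the product measure to \<open>lborel\<close>
  and, being linear, respects midpoints.\<close>

theorem prekopa_leindler:
  fixes f g h :: "'a::euclidean_space \<Rightarrow> ennreal"
  assumes [measurable]: "f \<in> borel_measurable borel" "g \<in> borel_measurable borel" "h \<in> borel_measurable borel"
    and mid: "\<And>x y. f x * g y \<le> (h ((1 / 2) *\<^sub>R (x + y)))\<^sup>2"
  shows "(\<integral>\<^sup>+x. f x \<partial>lborel) * (\<integral>\<^sup>+x. g x \<partial>lborel) \<le> (\<integral>\<^sup>+x. h x \<partial>lborel)\<^sup>2"
proof -
  define T :: "('a \<Rightarrow> real) \<Rightarrow> 'a" where "T v = (\<Sum>b\<in>Basis. v b *\<^sub>R b)" for v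
  have [measurable]: "T \<in> measurable (PiM Basis (\<lambda>_. lborel)) borel"
    unfolding T_def by measurable
  have eq: "(\<integral>\<^sup>+x. F x \<partial>lborel) = (\<integral>\<^sup>+v. F (T v) \<partial>PiM Basis (\<lambda>_. lborel))"
    if [measurable]: "F \<in> borel_measurable borel" for F :: "'a \<Rightarrow> ennreal"
    unfolding lborel_eq[where 'a = 'a] T_def[symmetric]
    by (subst nn_integral_distr) auto
  have "T (\<lambda>b\<in>Basis. (v b + w b) / 2) = (1 / 2) *\<^sub>R (T v + T w)" for v w
    by (simp add: T_def scaleR_sum_right sum.distrib[symmetric] scaleR_add_left[symmetric] add_divide_distrib)
  then show ?thesis
    using mid by (simp add: eq) (intro prekopa_leindler_PiM; simp)
qed

subsection \<open>The Poincare inequality for odd functions\<close>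

lemma has_derivative_mvt:
  fixes \<phi> :: "'a::real_inner \<Rightarrow> real"
  assumes "\<And>x. (\<phi> has_derivative (\<lambda>v. g x \<bullet> v)) (at x)"
  obtains t where "0 < t" "t < 1" "\<phi> x - \<phi> y = g (y + t *\<^sub>R (x - y)) \<bullet> (x - y)"
proof -
  have "((\<lambda>t. \<phi> (y + t *\<^sub>R (x - y))) has_derivative (\<lambda>s. s * (g (y + t *\<^sub>R (x - y)) \<bullet> (x - y)))) (at t)"
    for t :: real
  proof -
    have "((\<lambda>t. y + t *\<^sub>R (x - y)) has_derivative (\<lambda>s. s *\<^sub>R (x - y))) (at t)"
      by (auto intro!: derivative_eq_intros)
    from has_derivative_compose[OF this assms] show ?thesis by simp
  qed
  then have "\<exists>t::real. t > 0 \<and> t < 1 \<and> \<phi> (y + 1 *\<^sub>R (x - y)) - \<phi> (y + 0 *\<^sub>R (x - y))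
      = (1 - 0) * (g (y + t *\<^sub>R (x - y)) \<bullet> (x - y))"
    by (intro MVT2) (auto simp: has_field_derivative_def mult_commute_abs)
  then show ?thesis using that by auto
qed

text \<open>All terms of the power series are nonnegative, so its partial sum up to degree two is a
  lower bound.\<close>

lemma one_plus_half_square_le_cosh: "1 + t\<^sup>2 / 2 \<le> cosh (t::real)"
proof -
  let ?c = "\<lambda>n. if even n then t ^ n /\<^sub>R fact n else 0"
  have "(\<Sum>n<3. ?c n) \<le> suminf ?c"
    using cosh_converges[of t] by (intro sum_le_suminf) (auto simp: sums_iff zero_le_even_power)
  also have "suminf ?c = cosh t" using cosh_converges[of t] by (simp add: sums_iff)
  finally show ?thesis by (simp add: eval_nat_numeral)
qed

text \<open>This is the logarithm of the Prekopa-Leindler hypothesis, where the squared norm of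
  \<open>z\<close> is the gain from the Gaussian weight. For short \<open>z\<close> the gradient at
  the mean value point is comparable to that at \<open>m\<close>, and completing a square suffices.
  For long \<open>z\<close> the Gaussian gain alone absorbs the linear term, because
  \<open>2 * e * M < d\<close>.\<close>

lemma midpoint_bound:
  fixes \<phi> :: "'a::real_inner \<Rightarrow> real"
  assumes deriv: "\<And>x. (\<phi> has_derivative (\<lambda>v. g x \<bullet> v)) (at x)"
    and S: "convex S" "x \<in> S" "y \<in> S"
    and M: "\<And>x. x \<in> S \<Longrightarrow> norm (g x) \<le> M"
    and unif: "\<And>x y. x \<in> S \<Longrightarrow> y \<in> S \<Longrightarrow> dist x y < d \<Longrightarrow> (norm (g x))\<^sup>2 \<le> (norm (g y))\<^sup>2 + \<delta>"
    and e: "0 < e" "2 * e * M < d" "0 < \<delta>"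
  defines "m \<equiv> (1 / 2) *\<^sub>R (x + y)" and "z \<equiv> (1 / 2) *\<^sub>R (x - y)"
  shows "e * (\<phi> x - \<phi> y) - (norm z)\<^sup>2 \<le> e\<^sup>2 * ((norm (g m))\<^sup>2 + \<delta>)"
proof -
  obtain t where t: "0 < t" "t < 1" "\<phi> x - \<phi> y = g (y + t *\<^sub>R (x - y)) \<bullet> (x - y)"
    using has_derivative_mvt[OF deriv] by metis
  define \<xi> where "\<xi> = y + t *\<^sub>R (x - y)"
  have xi: "\<xi> = (1 - t) *\<^sub>R y + t *\<^sub>R x" by (simp add: \<xi>_def algebra_simps)
  have "\<xi> \<in> S" unfolding xi using S t by (intro convexD) auto
  have "m \<in> S" using convexD[OF S, of "1/2" "1/2"] by (simp add: m_def scaleR_add_right)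
  have eq: "\<phi> x - \<phi> y = 2 * (g \<xi> \<bullet> z)" using t(3) by (simp add: \<xi>_def z_def)
  show ?thesis
  proof (cases "norm z < d")
    case True
    \<comment> \<open>Since \<open>t\<close> lies in the unit interval, the mean value point is no
      farther from \<open>m\<close> than the endpoints are.\<close>
    have "\<xi> - m = (2 * t - 1) *\<^sub>R z"
      by (simp add: \<xi>_def m_def z_def algebra_simps) (simp add: scaleR_add_left[symmetric])
    then have "dist \<xi> m = \<bar>2 * t - 1\<bar> * norm z" by (simp add: dist_norm)
    also have "\<dots> \<le> 1 * norm z" using t by (intro mult_right_mono) auto
    finally have "dist \<xi> m < d" using True by simp
    then have u: "(norm (g \<xi>))\<^sup>2 \<le> (norm (g m))\<^sup>2 + \<delta>" using unif \<open>\<xi> \<in> S\<close> \<open>m \<in> S\<close> by blast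
    have "0 \<le> (norm (e *\<^sub>R g \<xi> - z))\<^sup>2" by simp
    also have "\<dots> = e\<^sup>2 * (norm (g \<xi>))\<^sup>2 - 2 * e * (g \<xi> \<bullet> z) + (norm z)\<^sup>2"
      unfolding power2_norm_eq_inner by (simp add: inner_diff inner_commute power2_eq_square algebra_simps)
    finally have "e * (\<phi> x - \<phi> y) - (norm z)\<^sup>2 \<le> e\<^sup>2 * (norm (g \<xi>))\<^sup>2" by (simp add: eq)
    also have "\<dots> \<le> e\<^sup>2 * ((norm (g m))\<^sup>2 + \<delta>)" using u by (intro mult_left_mono) auto
    finally show ?thesis .
  next
    case False
    have "g \<xi> \<bullet> z \<le> norm (g \<xi>) * norm z" by (rule norm_cauchy_schwarz)
    also have "\<dots> \<le> M * norm z" using M[OF \<open>\<xi> \<in> S\<close>] by (intro mult_right_mono) auto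
    finally have "2 * e * (g \<xi> \<bullet> z) \<le> (2 * e * M) * norm z" using e by simp
    also have "\<dots> \<le> norm z * norm z" using e False by (intro mult_right_mono) auto
    finally have "e * (\<phi> x - \<phi> y) - (norm z)\<^sup>2 \<le> 0" by (simp add: eq power2_eq_square)
    also have "0 \<le> e\<^sup>2 * ((norm (g m))\<^sup>2 + \<delta>)" using e by simp
    finally show ?thesis .
  qed
qed

text \<open>Left unnormalized, because the Poincare inequality is homogeneous in the measure; the
  constants enter only in the final normalization. The base is \<open>lborel\<close>, where
  Prekopa-Leindler is available.\<close>

definition gauss_on :: "'a::euclidean_space set \<Rightarrow> 'a measure" where
  "gauss_on S = density lborel (\<lambda>x. ennreal (indicator S x * exp (- (norm x)\<^sup>2 / 2)))"

lemma sets_gauss_on [measurable_cong, simp]: "sets (gauss_on S) = sets borel"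
  by (simp add: gauss_on_def)

lemma space_gauss_on [simp]: "space (gauss_on S) = UNIV"
  by (simp add: gauss_on_def)

lemma nn_integral_gauss_on:
  assumes "S \<in> sets borel" and "f \<in> borel_measurable borel"
  shows "(\<integral>\<^sup>+x. f x \<partial>gauss_on S) = (\<integral>\<^sup>+x. ennreal (indicator S x * exp (- (norm x)\<^sup>2 / 2)) * f x \<partial>lborel)"
  using assms unfolding gauss_on_def by (subst nn_integral_density) auto

lemma AE_gauss_on:
  assumes "S \<in> sets borel"
  shows "AE x in gauss_on S. x \<in> S"
  using assms unfolding gauss_on_def by (subst AE_density) (auto intro!: AE_I2 split: split_indicator_asm)

lemma finite_measure_gauss_on:
  assumes [measurable]: "S \<in> sets borel" and "bounded S"
  shows "finite_measure (gauss_on S)"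
proof
  have "emeasure (gauss_on S) UNIV = (\<integral>\<^sup>+x. 1 \<partial>gauss_on S)"
    by simp
  also have "\<dots> \<le> (\<integral>\<^sup>+x. indicator S x \<partial>lborel)"
    by (subst nn_integral_gauss_on, simp, simp, intro nn_integral_mono) (auto split: split_indicator)
  also have "\<dots> < \<infinity>" using emeasure_bounded_finite[OF assms(2)] by simp
  finally show "emeasure (gauss_on S) (space (gauss_on S)) \<noteq> \<infinity>" by simp
qed

lemma nn_integral_gauss_on_reflect:
  fixes f :: "'a::euclidean_space \<Rightarrow> ennreal"
  assumes [measurable]: "S \<in> sets borel" "f \<in> borel_measurable borel"
    and sym: "\<And>x. - x \<in> S \<longleftrightarrow> x \<in> S"
  shows "(\<integral>\<^sup>+x. f (- x) \<partial>gauss_on S) = (\<integral>\<^sup>+x. f x \<partial>gauss_on S)"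
proof -
  have *: "lborel = distr lborel borel (uminus :: 'a \<Rightarrow> 'a)"
    using lborel_affine[of "-1" "0::'a"] by (simp add: density_1)
  have "(\<integral>\<^sup>+x. f x \<partial>gauss_on S)
      = (\<integral>\<^sup>+x. ennreal (indicator S x * exp (- (norm x)\<^sup>2 / 2)) * f x \<partial>distr lborel borel uminus)"
    unfolding *[symmetric] by (simp add: nn_integral_gauss_on)
  also have "\<dots> = (\<integral>\<^sup>+x. ennreal (indicator S (- x) * exp (- (norm x)\<^sup>2 / 2)) * f (- x) \<partial>lborel)"
    by (subst nn_integral_distr) auto
  also have "\<dots> = (\<integral>\<^sup>+x. f (- x) \<partial>gauss_on S)"
    by (subst nn_integral_gauss_on) (auto simp: indicator_def sym)
  finally show ?thesis ..
qed

lemma ennreal_power2_le_imp_le: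
  fixes a b :: ennreal
  assumes "a\<^sup>2 \<le> b\<^sup>2"
  shows "a \<le> b"
proof (cases a; cases b)
  fix r s assume "a = ennreal r" "0 \<le> r" "b = ennreal s" "0 \<le> s"
  then show ?thesis using assms power2_le_imp_le[of r s] by (simp add: ennreal_power)
next
  fix s assume "a = top" "b = ennreal s" "0 \<le> s"
  then show ?thesis using assms by (simp add: ennreal_power power2_eq_square ennreal_top_mult ennreal_mult_eq_top_iff top_unique)
qed simp_all

text \<open>Prekopa-Leindler with the weight \<open>W\<close> included in all three functions. By
  convexity the weight at a midpoint of two points of \<open>S\<close> is positive; if a point lies
  outside \<open>S\<close>, the left side vanishes.\<close>

lemma gauss_on_exp_odd_le:
  fixes \<phi> :: "'a::euclidean_space \<Rightarrow> real"
  assumes deriv: "\<And>x. (\<phi> has_derivative (\<lambda>v. g x \<bullet> v)) (at x)"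
    and g: "continuous_on UNIV g"
    and odd: "\<And>x. \<phi> (- x) = - \<phi> x"
    and S: "S \<in> sets borel" "convex S" "\<And>x. - x \<in> S \<longleftrightarrow> x \<in> S"
    and M: "\<And>x. x \<in> S \<Longrightarrow> norm (g x) \<le> M"
    and unif: "\<And>x y. x \<in> S \<Longrightarrow> y \<in> S \<Longrightarrow> dist x y < d \<Longrightarrow> (norm (g x))\<^sup>2 \<le> (norm (g y))\<^sup>2 + \<delta>"
    and e: "0 < e" "2 * e * M < d" "0 < \<delta>"
  shows "(\<integral>\<^sup>+x. ennreal (exp (e * \<phi> x)) \<partial>gauss_on S)
    \<le> (\<integral>\<^sup>+x. ennreal (exp (e\<^sup>2 / 2 * ((norm (g x))\<^sup>2 + \<delta>))) \<partial>gauss_on S)"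
proof -
  have [measurable]: "S \<in> sets borel" by fact
  have [measurable]: "g \<in> borel_measurable borel" using g by (rule borel_measurable_continuous_onI)
  have "continuous_on UNIV \<phi>"
    using deriv by (auto intro!: continuous_at_imp_continuous_on has_derivative_continuous)
  then have [measurable]: "\<phi> \<in> borel_measurable borel" by (rule borel_measurable_continuous_onI)
  define W where "W x = indicator S x * exp (- (norm x)\<^sup>2 / 2)" for x :: 'a
  have W: "0 \<le> W x" for x by (simp add: W_def)
  let ?F = "\<lambda>x. ennreal (W x) * ennreal (exp (e * \<phi> x))"
  let ?G = "\<lambda>x. ennreal (W x) * ennreal (exp (- (e * \<phi> x)))"
  let ?H = "\<lambda>x. ennreal (W x) * ennreal (exp (e\<^sup>2 / 2 * ((norm (g x))\<^sup>2 + \<delta>)))"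
  have "(\<integral>\<^sup>+x. ?F x \<partial>lborel) * (\<integral>\<^sup>+x. ?G x \<partial>lborel) \<le> (\<integral>\<^sup>+x. ?H x \<partial>lborel)\<^sup>2"
  proof (rule prekopa_leindler)
    fix x y :: 'a
    define m where "m = (1 / 2) *\<^sub>R (x + y)"
    define z where "z = (1 / 2) *\<^sub>R (x - y)"
    show "?F x * ?G y \<le> (?H ((1 / 2) *\<^sub>R (x + y)))\<^sup>2"
    proof (cases "x \<in> S \<and> y \<in> S")
      case True
      then have "m \<in> S" using convexD[OF S(2), of x y "1/2" "1/2"] by (simp add: m_def scaleR_add_right)
      have *: "e * (\<phi> x - \<phi> y) - (norm z)\<^sup>2 \<le> e\<^sup>2 * ((norm (g m))\<^sup>2 + \<delta>)"
        unfolding m_def z_def using True by (intro midpoint_bound[OF deriv S(2) _ _ M unif e]) auto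
      \<comment> \<open>Parallelogram identity: it produces the term \<open>(norm z)^2\<close> that
        \<open>midpoint_bound\<close> spends.\<close>
      have par: "(norm x)\<^sup>2 / 2 + (norm y)\<^sup>2 / 2 = (norm m)\<^sup>2 + (norm z)\<^sup>2"
        unfolding power2_norm_eq_inner m_def z_def by (simp add: inner_add inner_diff inner_commute add_divide_distrib diff_divide_distrib)
      have "- (norm x)\<^sup>2 / 2 + e * \<phi> x + (- (norm y)\<^sup>2 / 2 - e * \<phi> y)
          \<le> 2 * (- (norm m)\<^sup>2 / 2 + e\<^sup>2 / 2 * ((norm (g m))\<^sup>2 + \<delta>))"
        using * par unfolding right_diff_distrib by simp
      then have "exp (- (norm x)\<^sup>2 / 2 + e * \<phi> x + (- (norm y)\<^sup>2 / 2 + - (e * \<phi> y)))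
          \<le> exp ((- (norm m)\<^sup>2 / 2 + e\<^sup>2 / 2 * ((norm (g m))\<^sup>2 + \<delta>))
            + (- (norm m)\<^sup>2 / 2 + e\<^sup>2 / 2 * ((norm (g m))\<^sup>2 + \<delta>)))" by simp
      moreover have "W x = exp (- (norm x)\<^sup>2 / 2)" "W y = exp (- (norm y)\<^sup>2 / 2)" "W m = exp (- (norm m)\<^sup>2 / 2)"
        using True \<open>m \<in> S\<close> by (auto simp: W_def)
      ultimately have "W x * exp (e * \<phi> x) * (W y * exp (- (e * \<phi> y)))
          \<le> (W m * exp (e\<^sup>2 / 2 * ((norm (g m))\<^sup>2 + \<delta>)))\<^sup>2"
        by (simp only: power2_eq_square[of "exp _ :: real"] mult_exp_exp)
      then show ?thesis
        unfolding m_def[symmetric] using W by (simp add: ennreal_mult[symmetric] ennreal_power)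
    qed (auto simp: W_def)
  qed (auto simp: W_def)
  then have "(\<integral>\<^sup>+x. ennreal (exp (e * \<phi> x)) \<partial>gauss_on S) * (\<integral>\<^sup>+x. ennreal (exp (e * \<phi> (- x))) \<partial>gauss_on S)
    \<le> (\<integral>\<^sup>+x. ennreal (exp (e\<^sup>2 / 2 * ((norm (g x))\<^sup>2 + \<delta>))) \<partial>gauss_on S)\<^sup>2"
    by (simp add: nn_integral_gauss_on W_def odd)
  \<comment> \<open>By oddness the second factor is the reflection of the first, so the left side
    becomes a square and the root can be taken.\<close>
  also have "(\<integral>\<^sup>+x. ennreal (exp (e * \<phi> (- x))) \<partial>gauss_on S) = (\<integral>\<^sup>+x. ennreal (exp (e * \<phi> x)) \<partial>gauss_on S)"
    by (rule nn_integral_gauss_on_reflect[where f = "\<lambda>x. ennreal (exp (e * \<phi> x))"]) (simp_all add: S)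
  finally show ?thesis
    unfolding power2_eq_square[symmetric] by (rule ennreal_power2_le_imp_le)
qed

lemma integrable_gauss_on_continuous:
  fixes f :: "'a::euclidean_space \<Rightarrow> real"
  assumes S: "S \<in> sets borel" "bounded S" and f: "continuous_on UNIV f"
  shows "integrable (gauss_on S) f"
proof -
  interpret finite_measure "gauss_on S" by (rule finite_measure_gauss_on[OF S])
  have "compact (closure S)" using S by simp
  then have "compact (f ` closure S)" using f by (intro compact_continuous_image) (auto intro: continuous_on_subset)
  then obtain B where B: "\<And>x. x \<in> closure S \<Longrightarrow> norm (f x) \<le> B"
    by (metis (no_types, lifting) bounded_iff compact_imp_bounded imageI)
  show ?thesis
  proof (rule integrable_const_bound)
    show "AE x in gauss_on S. norm (f x) \<le> B"
      using AE_gauss_on[OF S(1)] by eventually_elim (use B closure_subset in blast)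
    show "f \<in> borel_measurable (gauss_on S)"
      using borel_measurable_continuous_onI[OF f] by simp
  qed
qed

text \<open>Both sides of the exponential inequality are expanded to second order in
  \<open>e\<close>. The total mass cancels, and division by \<open>e^2 / 2\<close> leaves the claim
  up to an error below any given \<open>r\<close>.\<close>

theorem odd_poincare_gauss_on:
  fixes \<phi> :: "'a::euclidean_space \<Rightarrow> real"
  assumes deriv: "\<And>x. (\<phi> has_derivative (\<lambda>v. g x \<bullet> v)) (at x)"
    and g: "continuous_on UNIV g"
    and odd: "\<And>x. \<phi> (- x) = - \<phi> x"
    and S: "S \<in> sets borel" "convex S" "bounded S" "\<And>x. - x \<in> S \<longleftrightarrow> x \<in> S"
  shows "(\<integral>x. (\<phi> x)\<^sup>2 \<partial>gauss_on S) \<le> (\<integral>x. (norm (g x))\<^sup>2 \<partial>gauss_on S)"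
proof (rule field_le_epsilon)
  interpret finite_measure "gauss_on S" by (rule finite_measure_gauss_on[OF S(1,3)])
  define V where "V = measure (gauss_on S) UNIV"
  have V: "0 \<le> V" by (simp add: V_def)
  have \<phi>: "continuous_on UNIV \<phi>"
    using deriv by (auto intro!: continuous_at_imp_continuous_on has_derivative_continuous)
  have int: "integrable (gauss_on S) f" if "continuous_on UNIV f" for f :: "'a \<Rightarrow> real"
    using integrable_gauss_on_continuous[OF S(1,3) that] .
  have q: "continuous_on UNIV (\<lambda>x. (norm (g x))\<^sup>2)" using g by (intro continuous_intros)
  have comp: "compact (closure S)" using S(3) by simp
  have "bounded (g ` closure S)"
    using comp g by (intro compact_imp_bounded compact_continuous_image) (auto intro: continuous_on_subset)
  then obtain M where M: "0 < M" "\<And>x. x \<in> closure S \<Longrightarrow> norm (g x) \<le> M"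
    unfolding bounded_pos by blast
  fix r :: real assume "0 < r"
  \<comment> \<open>Half of the allowed error goes to \<open>\<delta>\<close>. The
    \<open>V + 1\<close> keeps the denominator positive even when \<open>V\<close> is zero.\<close>
  define \<delta> where "\<delta> = min 1 (r / (2 * (V + 1)))"
  have \<delta>: "0 < \<delta>" "\<delta> \<le> 1" "\<delta> * V \<le> r / 2"
  proof -
    show "0 < \<delta>" "\<delta> \<le> 1" using \<open>0 < r\<close> V by (simp_all add: \<delta>_def)
    have "\<delta> * V \<le> r / (2 * (V + 1)) * V" using V by (intro mult_right_mono) (simp_all add: \<delta>_def)
    also have "\<dots> \<le> r / 2" using V \<open>0 < r\<close> by (simp add: field_simps)
    finally show "\<delta> * V \<le> r / 2" .
  qed
  have "uniformly_continuous_on (closure S) (\<lambda>x. (norm (g x))\<^sup>2)"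
    using comp q by (intro compact_uniformly_continuous) (auto intro: continuous_on_subset)
  then obtain d where d: "0 < d"
    "\<And>x y. x \<in> closure S \<Longrightarrow> y \<in> closure S \<Longrightarrow> dist y x < d \<Longrightarrow> dist ((norm (g y))\<^sup>2) ((norm (g x))\<^sup>2) < \<delta>"
    unfolding uniformly_continuous_on_def using \<delta>(1) by meson
  \<comment> \<open>Bounds \<open>(norm (g x))^2 + \<delta>\<close> on \<open>S\<close>, since
    \<open>\<delta> \<le> 1\<close>.\<close>
  define L where "L = M\<^sup>2 + 1"
  have L: "0 < L" by (simp add: L_def add_nonneg_pos)
  \<comment> \<open>In order, the four bounds give \<open>2 * e * M < d\<close>, the estimate
    \<open>H x \<le> 1\<close> on \<open>S\<close>, the estimate \<open>e^2 \<le> e\<close>, and a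
    quadratic remainder using at most the other half of \<open>r\<close>.\<close>
  define e where "e = Min {d / (4 * M), 1 / L, 1, r / (L\<^sup>2 * (V + 1))}"
  have "0 < e" unfolding e_def using d(1) M(1) L V \<open>0 < r\<close> by simp
  have eM: "2 * e * M < d"
  proof -
    have "e \<le> d / (4 * M)" unfolding e_def by simp
    then have "4 * e * M \<le> d" using M(1) by (simp add: field_simps)
    moreover have "0 < e * M" using \<open>0 < e\<close> M(1) by simp
    ultimately show ?thesis by linarith
  qed
  have "e \<le> 1 / L" "e \<le> 1" "e \<le> r / (L\<^sup>2 * (V + 1))" unfolding e_def by auto
  have e2: "e\<^sup>2 \<le> e" using \<open>0 < e\<close> \<open>e \<le> 1\<close> by (simp add: power2_eq_square mult_left_le)
  define H where "H x = e\<^sup>2 / 2 * ((norm (g x))\<^sup>2 + \<delta>)" for x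
  have H: "continuous_on UNIV H" unfolding H_def using g by (intro continuous_intros)
  have "(\<integral>\<^sup>+x. ennreal (exp (e * \<phi> x)) \<partial>gauss_on S) \<le> (\<integral>\<^sup>+x. ennreal (exp (H x)) \<partial>gauss_on S)"
    unfolding H_def
  proof (rule gauss_on_exp_odd_le[where M = M and d = d, OF deriv g odd S(1,2,4)])
    show "norm (g x) \<le> M" if "x \<in> S" for x using M(2) that closure_subset by blast
    show "(norm (g x))\<^sup>2 \<le> (norm (g y))\<^sup>2 + \<delta>" if "x \<in> S" "y \<in> S" "dist x y < d" for x y
      using d(2)[of y x] that closure_subset[of S] by (force simp: dist_real_def)
  qed (use \<open>0 < e\<close> eM \<delta> in auto)
  then have "ennreal (\<integral>x. exp (e * \<phi> x) \<partial>gauss_on S) \<le> ennreal (\<integral>x. exp (H x) \<partial>gauss_on S)"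
    using \<phi> H by (subst (asm) (1 2) nn_integral_eq_integral) (auto intro!: int continuous_intros)
  then have le: "(\<integral>x. exp (e * \<phi> x) \<partial>gauss_on S) \<le> (\<integral>x. exp (H x) \<partial>gauss_on S)"
    by (simp add: ennreal_le_iff)
  have "(\<integral>x. exp (- (e * \<phi> x)) \<partial>gauss_on S) = (\<integral>x. exp (e * \<phi> x) \<partial>gauss_on S)"
  proof -
    have [measurable]: "\<phi> \<in> borel_measurable borel" by (rule borel_measurable_continuous_onI[OF \<phi>])
    have "(\<integral>\<^sup>+x. ennreal (exp (e * \<phi> (- x))) \<partial>gauss_on S) = (\<integral>\<^sup>+x. ennreal (exp (e * \<phi> x)) \<partial>gauss_on S)"
      by (rule nn_integral_gauss_on_reflect[where f = "\<lambda>x. ennreal (exp (e * \<phi> x))"]) (simp_all add: S)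
    then show ?thesis by (subst (1 2) integral_eq_nn_integral) (auto simp: odd)
  qed
  \<comment> \<open>Averaging the two equal integrals removes the term of first order and leaves
    \<open>cosh\<close>.\<close>
  then have "(\<integral>x. exp (e * \<phi> x) \<partial>gauss_on S)
      = (\<integral>x. exp (e * \<phi> x) \<partial>gauss_on S) / 2 + (\<integral>x. exp (- (e * \<phi> x)) \<partial>gauss_on S) / 2"
    by simp
  also have "\<dots> = (\<integral>x. cosh (e * \<phi> x) \<partial>gauss_on S)"
    using \<phi> by (simp add: cosh_def add_divide_distrib int continuous_on_exp continuous_on_mult_left continuous_on_minus)
  also have "\<dots> \<ge> (\<integral>x. 1 + e\<^sup>2 / 2 * (\<phi> x)\<^sup>2 \<partial>gauss_on S)"
    using \<phi> one_plus_half_square_le_cosh[of "e * \<phi> _"]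
    by (intro integral_mono int continuous_intros) (auto simp: power_mult_distrib)
  finally have "(\<integral>x. 1 + e\<^sup>2 / 2 * (\<phi> x)\<^sup>2 \<partial>gauss_on S) \<le> (\<integral>x. exp (H x) \<partial>gauss_on S)"
    using le by simp
  also have "\<dots> \<le> (\<integral>x. 1 + (e\<^sup>2 / 2 * (norm (g x))\<^sup>2 + e\<^sup>2 / 2 * (\<delta> + e\<^sup>2 * L\<^sup>2 / 2)) \<partial>gauss_on S)"
  proof (rule integral_mono_AE)
    show "AE x in gauss_on S. exp (H x) \<le> 1 + (e\<^sup>2 / 2 * (norm (g x))\<^sup>2 + e\<^sup>2 / 2 * (\<delta> + e\<^sup>2 * L\<^sup>2 / 2))"
      using AE_gauss_on[OF S(1)]
    proof eventually_elim
      case (elim x)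
      then have "(norm (g x))\<^sup>2 \<le> M\<^sup>2"
        using M closure_subset[of S] by (intro power_mono) auto
      then have HL: "H x \<le> e\<^sup>2 / 2 * L"
        unfolding H_def L_def using \<delta> by (intro mult_left_mono) auto
      have "0 \<le> H x" unfolding H_def using \<delta> by simp
      have "e\<^sup>2 * L \<le> e * L" using e2 L by (intro mult_right_mono) auto
      also have "\<dots> \<le> 1" using \<open>e \<le> 1 / L\<close> L by (simp add: field_simps)
      finally have "H x \<le> 1" using HL by linarith
      \<comment> \<open>The quadratic term is of order \<open>e^4\<close>, so it stays small after
        division by \<open>e^2 / 2\<close>.\<close>
      have "exp (H x) \<le> 1 + H x + (H x)\<^sup>2"
        by (rule exp_bound) fact+
      also have "(H x)\<^sup>2 \<le> (e\<^sup>2 / 2 * L)\<^sup>2" using HL \<open>0 \<le> H x\<close> by (intro power_mono)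
      also have "(e\<^sup>2 / 2 * L)\<^sup>2 = e\<^sup>2 / 2 * (e\<^sup>2 * L\<^sup>2 / 2)" by (simp add: power2_eq_square)
      finally show ?case unfolding H_def distrib_left by linarith
    qed
  qed (use H g in \<open>intro int continuous_intros; simp\<close>)+
  finally have mono: "(\<integral>x. 1 + e\<^sup>2 / 2 * (\<phi> x)\<^sup>2 \<partial>gauss_on S)
    \<le> (\<integral>x. 1 + (e\<^sup>2 / 2 * (norm (g x))\<^sup>2 + e\<^sup>2 / 2 * (\<delta> + e\<^sup>2 * L\<^sup>2 / 2)) \<partial>gauss_on S)" .
  have "integrable (gauss_on S) (\<lambda>x. (\<phi> x)\<^sup>2)" "integrable (gauss_on S) (\<lambda>x. (norm (g x))\<^sup>2)"
    using \<phi> g by (auto intro!: int continuous_intros)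
  then have "V + e\<^sup>2 / 2 * (\<integral>x. (\<phi> x)\<^sup>2 \<partial>gauss_on S)
     \<le> V + (e\<^sup>2 / 2 * (\<integral>x. (norm (g x))\<^sup>2 \<partial>gauss_on S) + V * (e\<^sup>2 / 2 * (\<delta> + e\<^sup>2 * L\<^sup>2 / 2)))"
    using mono by (simp add: V_def)
  moreover have "V * (e\<^sup>2 / 2 * (\<delta> + e\<^sup>2 * L\<^sup>2 / 2)) = e\<^sup>2 / 2 * ((\<delta> + e\<^sup>2 * L\<^sup>2 / 2) * V)"
    by (simp only: mult.commute mult.left_commute)
  ultimately have "e\<^sup>2 / 2 * (\<integral>x. (\<phi> x)\<^sup>2 \<partial>gauss_on S)
     \<le> e\<^sup>2 / 2 * ((\<integral>x. (norm (g x))\<^sup>2 \<partial>gauss_on S) + (\<delta> + e\<^sup>2 * L\<^sup>2 / 2) * V)"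
    unfolding distrib_left[of "e\<^sup>2 / 2"] by linarith
  then have "(\<integral>x. (\<phi> x)\<^sup>2 \<partial>gauss_on S) \<le> (\<integral>x. (norm (g x))\<^sup>2 \<partial>gauss_on S) + (\<delta> + e\<^sup>2 * L\<^sup>2 / 2) * V"
    by (rule mult_left_le_imp_le) (use \<open>0 < e\<close> in simp)
  also have "(\<delta> + e\<^sup>2 * L\<^sup>2 / 2) * V \<le> r"
  proof -
    have "e\<^sup>2 * L\<^sup>2 * V \<le> e * L\<^sup>2 * (V + 1)"
      using e2 V \<open>0 < e\<close> by (intro mult_mono) auto
    also have "\<dots> \<le> r"
      using \<open>e \<le> r / (L\<^sup>2 * (V + 1))\<close> L V
      by (subst (asm) pos_le_divide_eq) (simp_all add: mult.assoc)
    finally have "e\<^sup>2 * L\<^sup>2 * V \<le> r" .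
    moreover have "(\<delta> + e\<^sup>2 * L\<^sup>2 / 2) * V = \<delta> * V + e\<^sup>2 * L\<^sup>2 * V / 2" by (simp add: distrib_right)
    ultimately show ?thesis using \<delta>(3) by linarith
  qed
  finally show "(\<integral>x. (\<phi> x)\<^sup>2 \<partial>gauss_on S) \<le> (\<integral>x. (norm (g x))\<^sup>2 \<partial>gauss_on S) + r" by simp
qed

subsection \<open>The Hessian estimate\<close>

lemma linear_vec_eq_inner:
  fixes D :: "real ^ 'n \<Rightarrow> real"
  assumes "linear D"
  shows "D v = (\<chi> i. D (axis i 1)) \<bullet> v"
proof -
  have "D v = D (\<Sum>i\<in>UNIV. v $ i *\<^sub>R axis i 1)"
    using basis_expansion[of v] by (simp add: scalar_mult_eq_scaleR)
  also have "\<dots> = (\<Sum>i\<in>UNIV. v $ i * D (axis i 1))"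
    using assms by (simp add: linear_sum linear_scale)
  finally show ?thesis by (simp add: inner_vec_def mult.commute)
qed

text \<open>In the index order of \<open>hess\<close>, the gradient of the \<open>j\<close>-th
  partial derivative is the \<open>j\<close>-th column.\<close>

lemma C2_grad_has_derivative:
  assumes "C2 u"
  shows "((\<lambda>y. grad u y $ j) has_derivative (\<lambda>v. (\<chi> i. hess u x $ i $ j) \<bullet> v)) (at x)"
proof -
  let ?D = "frechet_derivative (\<lambda>y. grad u y $ j) (at x)"
  have "((\<lambda>y. grad u y $ j) has_derivative ?D) (at x)"
    using assms by (simp add: C2_def frechet_derivative_works[symmetric])
  moreover from this have "?D = (\<lambda>v. (\<chi> i. hess u x $ i $ j) \<bullet> v)"
    by (intro ext, subst linear_vec_eq_inner) (auto simp: hess_def dest: has_derivative_linear)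
  ultimately show ?thesis by (simp only:)
qed

text \<open>Chain rule for the composition of \<open>u\<close> with negation. It supplies the
  oddness that the Poincare inequality asks for.\<close>

lemma grad_even:
  assumes diff: "\<And>x. u differentiable (at x)" and even: "\<And>x. u (- x) = u x"
  shows "grad u (- x) = - grad u x"
proof -
  have "(u has_derivative frechet_derivative u (at (- x))) (at (- x))"
    using diff by (simp add: frechet_derivative_works[symmetric])
  from has_derivative_compose[OF has_derivative_minus[OF has_derivative_ident] this]
  have "(u has_derivative (\<lambda>v. frechet_derivative u (at (- x)) (- v))) (at x)"
    by (simp only: even)
  then have "frechet_derivative u (at x) = (\<lambda>v. frechet_derivative u (at (- x)) (- v))"
    by (rule frechet_derivative_at[symmetric])
  moreover have "linear (frechet_derivative u (at (- x)))"
    using diff by (simp add: linear_frechet_derivative)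
  then have "frechet_derivative u (at (- x)) (- v) = - frechet_derivative u (at (- x)) v" for v
    by (rule linear_neg)
  ultimately show ?thesis by (simp add: grad_def vec_eq_iff)
qed

lemma continuous_on_grad:
  assumes "C2 u"
  shows "continuous_on UNIV (grad u)"
proof -
  have "isCont (\<lambda>y. grad u y $ j) x" for j x
    by (rule has_derivative_continuous[OF C2_grad_has_derivative[OF assms]])
  then have "continuous_on UNIV (\<lambda>x. \<chi> j. grad u x $ j)"
    by (intro continuous_on_vec_lambda continuous_at_imp_continuous_on ballI)
  then show ?thesis by simp
qed

lemma continuous_on_hs_norm_sq_hess:
  assumes "C2 u"
  shows "continuous_on UNIV (\<lambda>x. hs_norm_sq (hess u x))"
  unfolding hs_norm_sq_def
  by (intro continuous_on_sum continuous_on_power) (use assms in \<open>simp add: C2_def\<close>)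

lemma integral_hess_grad_gauss_on_ge:
  fixes u :: "real ^ 'n \<Rightarrow> real"
  assumes u: "C2 u" "\<And>x. u (- x) = u x"
    and S: "S \<in> sets borel" "convex S" "bounded S" "\<And>x. - x \<in> S \<longleftrightarrow> x \<in> S"
    and OU: "\<And>x. x \<in> S \<Longrightarrow> OU u x = 1"
  shows "measure (gauss_on S) UNIV / real CARD('n)
    \<le> (\<integral>x. hs_norm_sq (hess u x) + (norm (grad u x))\<^sup>2 \<partial>gauss_on S)"
proof -
  interpret finite_measure "gauss_on S" by (rule finite_measure_gauss_on[OF S(1,3)])
  \<comment> \<open>The value that maximizes \<open>2 * c - c^2 * n\<close> for
    \<open>n = CARD('n)\<close>.\<close>
  define c where "c = 1 / real CARD('n)"
  have c: "0 < c" "c\<^sup>2 * real CARD('n) = c" by (simp_all add: c_def power2_eq_square)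
  define \<phi> where "\<phi> j x = grad u x $ j - c * x $ j" for j x
  define G where "G j x = (\<chi> i. hess u x $ i $ j) - c *\<^sub>R axis j 1" for j x
  define Q where "Q x = hs_norm_sq (hess u x) + (norm (grad u x))\<^sup>2" for x
  have cont_hess: "continuous_on UNIV (\<lambda>x. hess u x $ i $ j)" for i j
    using u(1) by (simp add: C2_def)
  have cont_G: "continuous_on UNIV (G j)" for j
    unfolding G_def by (intro continuous_intros cont_hess)
  have cont_\<phi>: "continuous_on UNIV (\<phi> j)" for j
    unfolding \<phi>_def by (intro continuous_intros continuous_on_grad u)
  have cont_Q: "continuous_on UNIV Q"
    unfolding Q_def by (intro continuous_intros continuous_on_hs_norm_sq_hess continuous_on_grad u)
  have int: "integrable (gauss_on S) f" if "continuous_on UNIV f" for f :: "_ \<Rightarrow> real"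
    using integrable_gauss_on_continuous[OF S(1,3) that] .
  have "(\<integral>x. (\<phi> j x)\<^sup>2 \<partial>gauss_on S) \<le> (\<integral>x. (norm (G j x))\<^sup>2 \<partial>gauss_on S)" for j
  proof (rule odd_poincare_gauss_on[OF _ cont_G _ S])
    show "\<phi> j (- x) = - \<phi> j x" for x
      using grad_even[of u x] u by (simp add: \<phi>_def C2_def)
    have lin: "((\<lambda>y. c * y $ j) has_derivative (\<lambda>v. c * v $ j)) (at x)" for x :: "real ^ 'n"
      by (intro bounded_linear_imp_has_derivative bounded_linear_const_mult bounded_linear_vec_nth)
    show "(\<phi> j has_derivative (\<lambda>v. G j x \<bullet> v)) (at x)" for x
      using has_derivative_diff[OF C2_grad_has_derivative[OF u(1), of j x] lin[of x]]
      by (simp add: \<phi>_def[abs_def] G_def inner_diff_left inner_axis')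
  qed
  then have "(\<Sum>j\<in>UNIV. \<integral>x. (\<phi> j x)\<^sup>2 \<partial>gauss_on S) \<le> (\<Sum>j\<in>UNIV. \<integral>x. (norm (G j x))\<^sup>2 \<partial>gauss_on S)"
    by (rule sum_mono)
  then have le: "(\<integral>x. (\<Sum>j\<in>UNIV. (\<phi> j x)\<^sup>2) \<partial>gauss_on S) \<le> (\<integral>x. (\<Sum>j\<in>UNIV. (norm (G j x))\<^sup>2) \<partial>gauss_on S)"
    using cont_G cont_\<phi> by (subst (1 2) Bochner_Integration.integral_sum) (auto intro!: int continuous_intros)
  \<comment> \<open>The cross terms pick out the diagonal entries of the Hessian, so their sum is
    the Laplacian.\<close>
  have sumG: "(\<Sum>j\<in>UNIV. (norm (G j x))\<^sup>2) = hs_norm_sq (hess u x) - 2 * c * laplacian u x + c" for x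
  proof -
    have "(norm (G j x))\<^sup>2 = (\<Sum>i\<in>UNIV. (hess u x $ i $ j)\<^sup>2) - 2 * c * hess u x $ j $ j + c\<^sup>2" for j
    proof -
      have "(norm (G j x))\<^sup>2 = (\<chi> i. hess u x $ i $ j) \<bullet> (\<chi> i. hess u x $ i $ j)
          - 2 * c * ((\<chi> i. hess u x $ i $ j) \<bullet> axis j 1) + c\<^sup>2 * (axis j 1 \<bullet> (axis j 1 :: real ^ 'n))"
        unfolding power2_norm_eq_inner G_def
        by (simp add: inner_diff inner_commute power2_eq_square)
      then show ?thesis
        by (simp add: inner_axis inner_axis_axis) (simp add: inner_vec_def power2_eq_square)
    qed
    then have "(\<Sum>j\<in>UNIV. (norm (G j x))\<^sup>2)
      = (\<Sum>j\<in>UNIV. \<Sum>i\<in>UNIV. (hess u x $ i $ j)\<^sup>2) - 2 * c * (\<Sum>j\<in>UNIV. hess u x $ j $ j) + c\<^sup>2 * real CARD('n)"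
      by (simp add: sum.distrib sum_subtractf sum_distrib_left)
    then show ?thesis
      unfolding hs_norm_sq_def laplacian_def c(2) by (subst sum.swap)
  qed
  have sum\<phi>: "(\<Sum>j\<in>UNIV. (\<phi> j x)\<^sup>2)
      = (norm (grad u x))\<^sup>2 - 2 * c * (\<Sum>i\<in>UNIV. x $ i * grad u x $ i) + c\<^sup>2 * (norm x)\<^sup>2" for x
  proof -
    have "(\<phi> j x)\<^sup>2 = grad u x $ j * grad u x $ j - 2 * c * (x $ j * grad u x $ j) + c\<^sup>2 * (x $ j * x $ j)" for j
      by (simp add: \<phi>_def power2_diff power_mult_distrib) (simp add: power2_eq_square)
    then show ?thesis
      by (simp add: power2_norm_eq_inner inner_vec_def sum.distrib sum_subtractf sum_distrib_left)
  qed
  have "0 \<le> (\<integral>x. (\<Sum>j\<in>UNIV. (norm (G j x))\<^sup>2) - (\<Sum>j\<in>UNIV. (\<phi> j x)\<^sup>2) \<partial>gauss_on S)"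
    using le cont_G cont_\<phi>
    by (subst Bochner_Integration.integral_diff) (auto intro!: int continuous_intros)
  also have "\<dots> \<le> (\<integral>x. Q x - c \<partial>gauss_on S)"
  proof (rule integral_mono_AE)
    show "AE x in gauss_on S. (\<Sum>j\<in>UNIV. (norm (G j x))\<^sup>2) - (\<Sum>j\<in>UNIV. (\<phi> j x)\<^sup>2) \<le> Q x - c"
      using AE_gauss_on[OF S(1)]
    proof eventually_elim
      case (elim x)
      \<comment> \<open>The equation for \<open>u\<close> merges the cross terms of both sums into
        \<open>- 2 * c\<close>. The difference is then the Hessian term minus
        \<open>(norm (grad u x))^2\<close>, \<open>c\<close> and \<open>c^2 * (norm x)^2\<close>,
        which is at most \<open>Q x - c\<close>.\<close>
      have lap: "laplacian u x = 1 + (\<Sum>i\<in>UNIV. x $ i * grad u x $ i)" using OU[OF elim] by (simp add: OU_def)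
      have "0 \<le> c\<^sup>2 * (norm x)\<^sup>2" "0 \<le> (norm (grad u x))\<^sup>2" by simp_all
      then show ?case unfolding sumG sum\<phi> Q_def lap distrib_left by linarith
    qed
  qed (use cont_G cont_\<phi> cont_Q in \<open>auto intro!: int continuous_intros\<close>)
  also have "\<dots> = (\<integral>x. Q x \<partial>gauss_on S) - c * measure (gauss_on S) UNIV"
    using int[OF cont_Q] by simp
  finally show ?thesis by (simp add: Q_def c_def)
qed

section \<open>Unbounded and non-Borel convex sets, and normalization\<close>

lemma nn_integral_exp_norm_sq_finite:
  "(\<integral>\<^sup>+x. ennreal (exp (- (norm (x::'a::euclidean_space))\<^sup>2 / 2)) \<partial>lborel) < \<infinity>"
proof -
  have "integrable lborel (\<lambda>x::real. sqrt (2 * pi) * std_normal_density x)" by simp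
  also have "(\<lambda>x::real. sqrt (2 * pi) * std_normal_density x) = (\<lambda>x. exp (- x\<^sup>2 / 2))"
    by (simp add: std_normal_density_def fun_eq_iff)
  finally have fin: "(\<integral>\<^sup>+x. ennreal (exp (- (x::real)\<^sup>2 / 2)) \<partial>lborel) < \<infinity>"
    by (simp add: integrable_iff_bounded)
  have "exp (- (norm x)\<^sup>2 / 2) = (\<Prod>b\<in>Basis. exp (- (x \<bullet> b)\<^sup>2 / 2))" for x :: 'a
    unfolding exp_sum[OF finite_Basis, symmetric] power2_norm_eq_inner euclidean_inner[of x x]
    by (simp add: sum_negf sum_divide_distrib power2_eq_square)
  then have "(\<integral>\<^sup>+x. ennreal (exp (- (norm (x::'a))\<^sup>2 / 2)) \<partial>lborel)
      = (\<integral>\<^sup>+x. (\<Prod>b\<in>Basis. ennreal (exp (- ((x::'a) \<bullet> b)\<^sup>2 / 2))) \<partial>lborel)"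
    by (simp add: prod_ennreal)
  also have "\<dots> = (\<Prod>b\<in>(Basis::'a set). \<integral>\<^sup>+x. ennreal (exp (- x\<^sup>2 / 2)) \<partial>lborel)"
    by (rule nn_integral_lborel_prod) auto
  also have "\<dots> < \<infinity>" using fin by (simp add: power_less_top_ennreal)
  finally show ?thesis .
qed

text \<open>A convex set need not be Borel, but it differs from its interior only by part of its
  negligible frontier.\<close>

lemma sets_lebesgue_convex:
  fixes K :: "'a::euclidean_space set"
  assumes "convex K"
  shows "K \<in> sets lebesgue"
proof -
  have "K - interior K \<subseteq> frontier K" using closure_subset[of K] by (auto simp: frontier_def)
  then have "negligible (K - interior K)"
    using negligible_convex_frontier[OF assms] negligible_subset by blast
  then have "K - interior K \<in> sets lebesgue" by (rule negligible_imp_sets)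
  moreover have "interior K \<in> sets lebesgue" by (simp add: borel_open)
  moreover have "K = interior K \<union> (K - interior K)" using interior_subset[of K] by auto
  ultimately show ?thesis by (metis sets.Un)
qed

lemma nn_integral_gauss_on_interior:
  fixes K :: "(real ^ 'n) set"
  assumes "convex K" and [measurable]: "f \<in> borel_measurable borel"
  shows "(\<integral>\<^sup>+x. ennreal (indicator K x * exp (- (norm x)\<^sup>2 / 2)) * f x \<partial>lebesgue)
    = (\<integral>\<^sup>+x. f x \<partial>gauss_on (interior K))"
proof -
  have "frontier K \<in> null_sets lebesgue"
    using negligible_convex_frontier[OF assms(1)] by (simp add: negligible_iff_null_sets)
  then have "AE x in lebesgue. x \<notin> frontier K" by (rule AE_not_in)
  then have "(\<integral>\<^sup>+x. ennreal (indicator K x * exp (- (norm x)\<^sup>2 / 2)) * f x \<partial>lebesgue)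
    = (\<integral>\<^sup>+x. ennreal (indicator (interior K) x * exp (- (norm x)\<^sup>2 / 2)) * f x \<partial>lebesgue)"
    by (intro nn_integral_cong_AE, eventually_elim)
      (use interior_subset[of K] closure_subset[of K] in \<open>auto simp: frontier_def split: split_indicator\<close>)
  then show ?thesis by (simp add: nn_integral_completion nn_integral_gauss_on)
qed

text \<open>Exhaustion by balls, whose intersections with \<open>G\<close> stay convex, symmetric
  and bounded. Nonnegative integrals admit an infinite right side, so only the mass on the left has
  to pass to the limit.\<close>

lemma nn_integral_hess_grad_gauss_on_ge:
  fixes u :: "real ^ 'n \<Rightarrow> real"
  assumes u: "C2 u" "\<And>x. u (- x) = u x"
    and G: "open G" "convex G" "\<And>x. - x \<in> G \<longleftrightarrow> x \<in> G"
    and OU: "\<And>x. x \<in> G \<Longrightarrow> OU u x = 1"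
  shows "ennreal (1 / real CARD('n)) * emeasure (gauss_on G) UNIV
    \<le> (\<integral>\<^sup>+x. ennreal (hs_norm_sq (hess u x) + (norm (grad u x))\<^sup>2) \<partial>gauss_on G)"
proof -
  define Q where "Q x = hs_norm_sq (hess u x) + (norm (grad u x))\<^sup>2" for x
  have Q: "continuous_on UNIV Q"
    unfolding Q_def by (intro continuous_intros continuous_on_hs_norm_sq_hess continuous_on_grad u)
  then have [measurable]: "Q \<in> borel_measurable borel" by (rule borel_measurable_continuous_onI)
  have [measurable]: "G \<in> sets borel" using G by simp
  have Q0: "0 \<le> Q x" for x by (simp add: Q_def hs_norm_sq_def sum_nonneg)
  define B :: "nat \<Rightarrow> (real ^ 'n) set" where "B k = ball 0 (real k)" for k
  have [measurable]: "B k \<in> sets borel" for k by (simp add: B_def)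
  have "ennreal (1 / real CARD('n)) * emeasure (gauss_on G) (B k) \<le> (\<integral>\<^sup>+x. Q x \<partial>gauss_on G)" for k
  proof -
    have S: "G \<inter> B k \<in> sets borel" "convex (G \<inter> B k)" "bounded (G \<inter> B k)" "\<And>x. - x \<in> G \<inter> B k \<longleftrightarrow> x \<in> G \<inter> B k"
      using G by (auto simp: B_def convex_Int bounded_Int)
    interpret finite_measure "gauss_on (G \<inter> B k)" by (rule finite_measure_gauss_on[OF S(1,3)])
    have "emeasure (gauss_on G) (B k) = emeasure (gauss_on (G \<inter> B k)) UNIV"
      unfolding gauss_on_def by (auto simp: emeasure_density intro!: nn_integral_cong split: split_indicator)
    then have "ennreal (1 / real CARD('n)) * emeasure (gauss_on G) (B k)
        = ennreal (measure (gauss_on (G \<inter> B k)) UNIV / real CARD('n))"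
      by (simp add: emeasure_eq_measure ennreal_mult'[symmetric])
    also have "\<dots> \<le> ennreal (\<integral>x. Q x \<partial>gauss_on (G \<inter> B k))"
      unfolding Q_def by (intro ennreal_leI integral_hess_grad_gauss_on_ge u S) (use OU in auto)
    also have "\<dots> = (\<integral>\<^sup>+x. Q x \<partial>gauss_on (G \<inter> B k))"
      by (intro nn_integral_eq_integral[symmetric] integrable_gauss_on_continuous S Q) (simp add: Q0)
    also have "\<dots> \<le> (\<integral>\<^sup>+x. Q x \<partial>gauss_on G)"
      by (subst (1 2) nn_integral_gauss_on) (auto intro!: nn_integral_mono split: split_indicator)
    finally show ?thesis .
  qed
  then have "ennreal (1 / real CARD('n)) * (SUP k. emeasure (gauss_on G) (B k)) \<le> (\<integral>\<^sup>+x. Q x \<partial>gauss_on G)"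
    unfolding SUP_mult_left_ennreal by (rule SUP_least)
  also have "(SUP k. emeasure (gauss_on G) (B k)) = emeasure (gauss_on G) (\<Union>k. B k)"
    by (intro SUP_emeasure_incseq) (auto simp: B_def incseq_def)
  also have "(\<Union>k. B k) = UNIV" by (auto simp: B_def reals_Archimedean2)
  finally show ?thesis by (simp add: Q_def)
qed

theorem theorem1p3:
  fixes K :: "(real ^ 'n) set" and u :: "real ^ 'n \<Rightarrow> real"
  assumes "convex K"
    and "\<forall>x\<in>K. - x \<in> K"
    and "interior K \<noteq> {}"
    and "C2 u"
    and "\<forall>x. u (- x) = u x"
    and "\<forall>x\<in>K. OU u x = 1"
  shows "(\<integral>\<^sup>+ x. ennreal (hs_norm_sq (hess u x) + (norm (grad u x))\<^sup>2) \<partial>gaussian_restr K)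
           \<ge> ennreal (1 / real CARD('n))"
proof -
  let ?Q = "\<lambda>x. ennreal (hs_norm_sq (hess u x) + (norm (grad u x))\<^sup>2)"
  have "continuous_on UNIV (\<lambda>x. hs_norm_sq (hess u x) + (norm (grad u x))\<^sup>2)"
    by (intro continuous_intros continuous_on_hs_norm_sq_hess continuous_on_grad assms)
  then have Q: "?Q \<in> borel_measurable borel"
    by (intro measurable_compose[OF borel_measurable_continuous_onI measurable_ennreal])
  have QL: "?Q \<in> borel_measurable lebesgue" using Q by (intro measurable_completion) simp
  have "- x \<in> interior K \<longleftrightarrow> x \<in> interior K" for x
  proof -
    have "uminus ` K = K" using assms(2) by (force intro: image_eqI[of _ _ "- _"])
    then have "uminus ` interior K = interior K" using interior_negations[of K] by simp
    then show ?thesis by (metis image_eqI minus_minus)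
  qed
  then have main: "ennreal (1 / real CARD('n)) * emeasure (gauss_on (interior K)) UNIV
      \<le> (\<integral>\<^sup>+x. ?Q x \<partial>gauss_on (interior K))"
    using assms interior_subset[of K]
    by (intro nn_integral_hess_grad_gauss_on_ge) (auto intro: convex_interior)
  define C where "C = (2 * pi) powr (- real CARD('n) / 2)"
  have "0 < C" by (simp add: C_def)
  have [measurable]: "K \<in> sets lebesgue" by (rule sets_lebesgue_convex[OF assms(1)])
  define A where "A = emeasure (gauss_on (interior K)) UNIV"
  have A: "A = (\<integral>\<^sup>+x. 1 \<partial>gauss_on (interior K))" by (simp add: A_def)
  have "A \<le> (\<integral>\<^sup>+x. ennreal (exp (- (norm (x :: real ^ 'n))\<^sup>2 / 2)) \<partial>lborel)"
    unfolding A by (subst nn_integral_gauss_on) (auto intro!: nn_integral_mono split: split_indicator)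
  then have "A < \<infinity>" using nn_integral_exp_norm_sq_finite by (rule le_less_trans)
  \<comment> \<open>A nonempty open set is not null. Together with finiteness this allows division
    by \<open>A\<close> at the end.\<close>
  have "A \<noteq> 0"
  proof
    assume "A = 0"
    then have "AE x in lborel. x \<notin> interior K"
      unfolding A by (subst (asm) nn_integral_gauss_on)
        (auto simp: nn_integral_0_iff_AE split: split_indicator_asm elim!: eventually_mono)
    then have "interior K \<in> null_sets lborel" by (simp add: AE_iff_null_sets)
    then show False
      using open_not_negligible[OF open_interior assms(3)] negligible_iff_null_sets null_sets_completionI by blast
  qed
  \<comment> \<open>Transfers integrals over \<open>K\<close> to the unnormalized weight on the
    interior; the case \<open>f = 1\<close> gives the normalizing mass.\<close>
  have gaussK: "(\<integral>\<^sup>+x. indicator K x * f x \<partial>gaussian) = ennreal C * (\<integral>\<^sup>+x. f x \<partial>gauss_on (interior K))"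
    if [measurable]: "f \<in> borel_measurable borel" for f
  proof -
    have [measurable]: "f \<in> borel_measurable lebesgue" using that by (intro measurable_completion) simp
    have "(\<lambda>x. exp (- (norm (x :: real ^ 'n))\<^sup>2 / 2)) \<in> borel_measurable lborel" by measurable
    then have [measurable]: "(\<lambda>x. exp (- (norm (x :: real ^ 'n))\<^sup>2 / 2)) \<in> borel_measurable lebesgue"
      by (rule measurable_completion)
    have "(\<integral>\<^sup>+x. indicator K x * f x \<partial>gaussian)
        = (\<integral>\<^sup>+x. ennreal C * (ennreal (indicator K x * exp (- (norm x)\<^sup>2 / 2)) * f x) \<partial>lebesgue)"
      unfolding gaussian_def C_def[symmetric]
    proof (subst nn_integral_density)
      have "ennreal (C * exp (- (norm x)\<^sup>2 / 2)) * (indicator K x * f x)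
          = ennreal C * (ennreal (indicator K x * exp (- (norm x)\<^sup>2 / 2)) * f x)" for x
        by (cases "x \<in> K") (simp_all add: ennreal_mult' less_imp_le[OF \<open>0 < C\<close>] mult.assoc)
      then show "(\<integral>\<^sup>+x. ennreal (C * exp (- (norm x)\<^sup>2 / 2)) * (indicator K x * f x) \<partial>lebesgue)
          = (\<integral>\<^sup>+x. ennreal C * (ennreal (indicator K x * exp (- (norm x)\<^sup>2 / 2)) * f x) \<partial>lebesgue)"
        by (simp only:)
    qed measurable
    also have "\<dots> = ennreal C * (\<integral>\<^sup>+x. ennreal (indicator K x * exp (- (norm x)\<^sup>2 / 2)) * f x \<partial>lebesgue)"
      by (rule nn_integral_cmult) measurable
    also note nn_integral_gauss_on_interior[OF assms(1) that]
    finally show ?thesis .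
  qed
  have setsG: "sets gaussian = sets lebesgue" by (simp add: gaussian_def)
  have emK: "emeasure gaussian K = ennreal C * A"
    using gaussK[of "\<lambda>_. 1"] by (simp add: A setsG)
  have "(\<integral>\<^sup>+x. ?Q x \<partial>gaussian_restr K) = (\<integral>\<^sup>+x. indicator K x / (ennreal C * A) * ?Q x \<partial>gaussian)"
    unfolding gaussian_restr_def emK
    using QL by (subst nn_integral_density) (auto simp: measurable_cong_sets[OF setsG refl])
  also have "\<dots> = (\<integral>\<^sup>+x. (indicator K x * ?Q x) / (ennreal C * A) \<partial>gaussian)"
    by (simp only: divide_ennreal_def ac_simps)
  also have "\<dots> = (\<integral>\<^sup>+x. indicator K x * ?Q x \<partial>gaussian) / (ennreal C * A)"
    using QL by (intro nn_integral_divide) (simp add: measurable_cong_sets[OF setsG refl])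
  \<comment> \<open>The Gaussian constant \<open>C\<close> occurs in both numerator and denominator
    and cancels, being positive and finite.\<close>
  also have "\<dots> = (\<integral>\<^sup>+x. ?Q x \<partial>gauss_on (interior K)) / A"
    unfolding gaussK[OF Q] mult.commute[of "ennreal C"] using \<open>0 < C\<close> by (intro divide_mult_eq) auto
  also have "\<dots> \<ge> ennreal (1 / real CARD('n)) * A / A"
    using main unfolding A_def by (rule divide_right_mono_ennreal)
  also have "ennreal (1 / real CARD('n)) * A / A = ennreal (1 / real CARD('n))"
    using \<open>A \<noteq> 0\<close> \<open>A < \<infinity>\<close> by (simp add: ennreal_mult_divide_eq)
  finally show ?thesis .
qed

end
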